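(* Let $G(z,y)=\frac12 e^{-|z-y|}$, $g_l(z)=e^{z-1}$, $g_r(z)=e^{1-z}$, and let $\zeta$ be a location between the two clusters of $z$-locations of the left child and the right child of the root node. If we choose $\tilde\gamma=\frac{e^{-\zeta}}{\sqrt2}$, then: \begin{itemize} \item For the left child, the new function $G_l(z,y)=G(z,y)-\tilde\gamma^2\cdot g_l(z)\cdot g_l(y)$ is the Green's function of the ODE problem $$u_1(z)-u_1''(z)=f(z),\quad z\in[0,\zeta],\qquad u_1(0)=u_1'(0),\quad u_1(\zeta)=0.$$ The function $G_l(z,y)$ is positive definite. \item For the right child, the new function $G_r(z,y)=G(z,y)-\frac{1}{\tilde\gamma^2}\cdot g_r(z)\cdot g_r(y)$ is the Green's function of the ODE problem $$u_2(z)-u_2''(z)=f(z),\quad z\in[\zeta,1],\qquad u_2(\zeta)=0,\quad u_2(1)=-u_2'(1).$$ The function $G_r(z,y)$ is positive definite. \item The two child ODE problem solutions $u_1(z)$ and $u_2(z)$ can be derived by subtracting a single layer potential defined at $z=\zeta$ from the solution $u(z)$ of the parent problem $$u(z)-u''(z)=f(z),\quad z\in[0,1],\qquad u(0)=u'(0),\quad u(1)=-u'(1),$$ so that $u_1(z)$ and $u_2(z)$ satisfy the zero interface condition at $z=\zeta$. The other boundary condition for each child ODE problem is the same as its parent's boundary condition. \end{itemize}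
   Context: Locations $z_1,\dots,z_N\in[0,1]$, ordered from smallest to largest, are divided into two clusters of equal size: those of the left child and those of the right child of the root node. Every location of the left child is smaller than every location of the right child. The point $\zeta$ is any point between the two clusters (its choice is not unique). The function $G$ satisfies $G(z,y)=\frac12 g_r(z)g_l(y)$ for $z\ge y$ and $G(z,y)=\frac12 g_r(y)g_l(z)$ for $z<y$. It is the Green's function of the parent problem stated in the claim, i.e. $u(z)=\int_0^1G(z,y)f(y)\,dy$ solves that problem. In general, a function $K(z,y)$ is the Green's function of a two-point boundary value problem on an interval $I$ with right-hand side $f$ if $v(z)=\int_I K(z,y)f(y)\,dy$ satisfies the ODE and the boundary conditions. Here $G_l$ is considered on $[0,\zeta]\times[0,\zeta]$ and $G_r$ on $[\zeta,1]\times[\zeta,1]$. A two-variable function $K(z,y)$ on $I\times I$ is positive definite if $\int_I f(z)\left(\int_I K(z,y)f(y)\,dy\right)dz>0$ for every $f\neq0$. A single layer potential defined at $z=\zeta$ is a function $z\mapsto\sigma G(z,\zeta)$ with $\sigma$ a constant.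
   Formalization: As printed, G_l(ζ,y) and G_r(ζ,y) are nonzero, so u_1(ζ)=0 and u_2(ζ)=0 fail for every ζ in (0,1). Corrected: γ̃ = e^{1-ζ}/√2 instead of e^{-ζ}/√2, and G_r = G − (1/(4γ̃²)) g_r(z) g_r(y) instead of coefficient 1/γ̃². *)

theory Defs
  imports "HOL-Analysis.Analysis"
begin

section \<open>Locations and the two clusters\<close>

text \<open>Locations are \<open>z 1, \<dots>, z N\<close>; the left child of the root holds the first half
  of the indices and the right child the second half.\<close>

definition left_child :: "nat \<Rightarrow> nat set" where
  "left_child N = {1..N div 2}"

definition right_child :: "nat \<Rightarrow> nat set" where
  "right_child N = {N div 2 + 1..N}"

definition clustered_locations :: "nat \<Rightarrow> (nat \<Rightarrow> real) \<Rightarrow> bool" where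
  "clustered_locations N z \<longleftrightarrow>
     N > 0 \<and> even N \<and> (\<forall>i\<in>{1..N}. z i \<in> {0..1}) \<and> mono_on {1..N} z \<and>
     (\<forall>i\<in>left_child N. \<forall>j\<in>right_child N. z i < z j)"

definition between_clusters :: "nat \<Rightarrow> (nat \<Rightarrow> real) \<Rightarrow> real \<Rightarrow> bool" where
  "between_clusters N z \<zeta> \<longleftrightarrow>
     (\<forall>i\<in>left_child N. z i < \<zeta>) \<and> (\<forall>j\<in>right_child N. \<zeta> < z j)"

section \<open>Two-point boundary value problems and Green's functions\<close>

text \<open>A boundary condition is a relation between the value and the first derivative of the
  solution at that end. Derivatives are taken within \<open>{a..b}\<close>, hence one-sided at the ends.\<close>

type_synonym bc = "real \<Rightarrow> real \<Rightarrow> bool"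

definition bc_left :: bc where
  "bc_left v v' \<longleftrightarrow> v = v'"

definition bc_right :: bc where
  "bc_right v v' \<longleftrightarrow> v = - v'"

definition bc_zero :: bc where
  "bc_zero v v' \<longleftrightarrow> v = 0"

definition solves_bvp ::
  "real \<Rightarrow> real \<Rightarrow> bc \<Rightarrow> bc \<Rightarrow> (real \<Rightarrow> real) \<Rightarrow> (real \<Rightarrow> real) \<Rightarrow> bool" where
  "solves_bvp a b L R f u \<longleftrightarrow>
     (\<exists>u' u''.
        (\<forall>z\<in>{a..b}. (u has_real_derivative u' z) (at z within {a..b}) \<and>
                    (u' has_real_derivative u'' z) (at z within {a..b}) \<and>
                    u z - u'' z = f z) \<and>
        L (u a) (u' a) \<and> R (u b) (u' b))"

definition kernel_op ::
  "real \<Rightarrow> real \<Rightarrow> (real \<Rightarrow> real \<Rightarrow> real) \<Rightarrow> (real \<Rightarrow> real) \<Rightarrow> real \<Rightarrow> real" where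
  "kernel_op a b K f z = (LBINT y:{a..b}. K z y * f y)"

text \<open>The equation is understood pointwise, so right-hand sides are continuous.\<close>

definition is_greens_function ::
  "real \<Rightarrow> real \<Rightarrow> bc \<Rightarrow> bc \<Rightarrow> (real \<Rightarrow> real \<Rightarrow> real) \<Rightarrow> bool" where
  "is_greens_function a b L R K \<longleftrightarrow>
     (\<forall>f. continuous_on {a..b} f \<longrightarrow> solves_bvp a b L R f (kernel_op a b K f))"

text \<open>Test functions range over the nonzero elements of \<open>L\<^sup>2\<close>; this includes every
  continuous function that is not identically zero on a nondegenerate interval.\<close>

definition positive_definite_kernel ::
  "real \<Rightarrow> real \<Rightarrow> (real \<Rightarrow> real \<Rightarrow> real) \<Rightarrow> bool" where
  "positive_definite_kernel a b K \<longleftrightarrow>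
     (\<forall>f. set_borel_measurable lborel {a..b} f \<and>
          set_integrable lborel {a..b} (\<lambda>z. (f z)\<^sup>2) \<and>
          \<not> (AE z\<in>{a..b} in lborel. f z = 0) \<longrightarrow>
          (LBINT z:{a..b}. f z * kernel_op a b K f z) > 0)"

section \<open>The kernels\<close>

definition G :: "real \<Rightarrow> real \<Rightarrow> real" where
  "G z y = 1 / 2 * exp (- \<bar>z - y\<bar>)"

definition g_l :: "real \<Rightarrow> real" where
  "g_l z = exp (z - 1)"

definition g_r :: "real \<Rightarrow> real" where
  "g_r z = exp (1 - z)"

text \<open>In \<open>G_l\<close> and \<open>G_r\<close>, \<open>\<gamma>\<close> stands for \<open>exp (1 - \<zeta>) / sqrt 2\<close>. The source prints
  \<open>\<gamma> = exp (- \<zeta>) / sqrt 2\<close> and the coefficient \<open>1 / \<gamma>\<^sup>2\<close> in \<open>G_r\<close>; with \<open>g_l\<close>, \<open>g_r\<close>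
  normalised as above, \<open>G_l \<gamma> \<zeta> y\<close> and \<open>G_r \<gamma> \<zeta> y\<close> would then be nonzero, contradicting the
  zero condition at \<open>\<zeta>\<close>. That condition forces the coefficient \<open>exp (2 - 2 * \<zeta>) / 2 = \<gamma>\<^sup>2\<close>
  in \<open>G_l\<close> and \<open>exp (2 * \<zeta> - 2) / 2 = 1 / (4 * \<gamma>\<^sup>2)\<close> in \<open>G_r\<close>. The factor 4 comes from the
  1/2 in \<open>G z y = 1 / 2 * g_r z * g_l y\<close> for \<open>y \<le> z\<close>.\<close>

definition G_l :: "real \<Rightarrow> real \<Rightarrow> real \<Rightarrow> real" where
  "G_l \<gamma> z y = G z y - \<gamma>\<^sup>2 * g_l z * g_l y"

definition G_r :: "real \<Rightarrow> real \<Rightarrow> real \<Rightarrow> real" where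
  "G_r \<gamma> z y = G z y - 1 / (4 * \<gamma>\<^sup>2) * g_r z * g_r y"

definition single_layer :: "real \<Rightarrow> real \<Rightarrow> real \<Rightarrow> real" where
  "single_layer \<sigma> \<zeta> z = \<sigma> * G z \<zeta>"

end

theory Submission
  imports Defs
begin

text \<open>All three kernels are of the form \<open>exp (- \<bar>z - y\<bar>) / 2 - p exp (z + y) - q exp (- z - y)\<close>.
  Splitting the integral at \<open>y = z\<close> writes \<open>\<integral> K z y f y dy\<close> as a combination of
  \<open>exp z\<close> and \<open>exp (- z)\<close> with indefinite integrals as coefficients, which can be differentiated
  twice; \<open>p\<close> and \<open>q\<close> enter only through the boundary values.

  Positive definiteness comes from the factorisation \<open>K z y = \<integral> \<phi> s z \<phi> s y ds\<close> with
  \<open>\<phi> s z = exp (z - s)\<close> for \<open>z \<le> s\<close> (left child) or \<open>\<phi> s z = exp (s - z)\<close> for \<open>s \<le> z\<close>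
  (right child) and \<open>\<phi> s z = 0\<close> otherwise: by Fubini the quadratic form is
  \<open>\<integral> (\<integral> \<phi> s z f z dz)\<^sup>2 ds\<close>, and it vanishes only if all indefinite integrals of
  \<open>exp z f z\<close> (respectively \<open>exp (- z) f z\<close>) do, that is, only if \<open>f = 0\<close> almost everywhere.

  On either side of \<open>\<zeta>\<close> the single layer potential is a multiple of \<open>exp z\<close> or \<open>exp (- z)\<close>, so
  it solves the homogeneous equation and the outer boundary condition.\<close>

section \<open>Green's functions by splitting the integral at the diagonal\<close>

lemma kernel_op_eq_integral:
  assumes "continuous_on {a..b} f" and "continuous_on {a..b} (K z)"
  shows "kernel_op a b K f z = integral {a..b} (\<lambda>y. K z y * f y)"
  unfolding kernel_op_def
  by (intro set_borel_integral_eq_integral borel_integrable_atLeastAtMost' continuous_intros assms)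

lemma is_greens_function_exp_kernel:
  fixes a b p q :: real
  defines "K \<equiv> \<lambda>z y. exp (- \<bar>z - y\<bar>) / 2 - p * exp (z + y) - q * exp (- z - y)"
  assumes L: "\<And>A B. L ((1/2 * exp a - q * exp (- a)) * B - p * exp a * A)
                      ((1/2 * exp a + q * exp (- a)) * B - p * exp a * A)"
    and R: "\<And>A B. R ((1/2 * exp (- b) - p * exp b) * A - q * exp (- b) * B)
                     ((- 1/2 * exp (- b) - p * exp b) * A + q * exp (- b) * B)"
    and ab: "a \<le> b"
  shows "is_greens_function a b L R K"
  unfolding is_greens_function_def
proof (intro allI impI)
  fix f :: "real \<Rightarrow> real"
  assume f: "continuous_on {a..b} f"
  let ?P = "\<lambda>z. integral {a..z} (\<lambda>y. exp y * f y)"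
  let ?Q = "\<lambda>z. integral {z..b} (\<lambda>y. exp (- y) * f y)"
  define A where "A = ?P b"
  define B where "B = ?Q a"
  define v where "v z = 1/2 * exp (- z) * ?P z + 1/2 * exp z * ?Q z
    - p * exp z * A - q * exp (- z) * B" for z
  define v' where "v' z = - 1/2 * exp (- z) * ?P z + 1/2 * exp z * ?Q z
    - p * exp z * A + q * exp (- z) * B" for z
  have ce: "continuous_on {a..b} (\<lambda>y. exp y * f y)" "continuous_on {a..b} (\<lambda>y. exp (- y) * f y)"
    by (intro continuous_intros f)+
  have dP: "(?P has_real_derivative exp z * f z) (at z within {a..b})" if "z \<in> {a..b}" for z
    using integral_has_real_derivative[OF ce(1) that] .
  have dQ: "(?Q has_real_derivative - (exp (- z) * f z)) (at z within {a..b})" if "z \<in> {a..b}" for z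
    using integral_has_real_derivative'[OF ce(2) that] .
  have ee: "exp z * (exp (- z) * c) = c" for z c :: real
    by (simp add: exp_minus)
  have ee': "exp (- z) * (exp z * c) = c" for z c :: real
    by (simp add: exp_minus)
  \<comment> \<open>Differentiating the two indefinite integrals contributes \<open>f z / 2\<close>
    and \<open>- f z / 2\<close>, which cancel in \<open>v'\<close>. In the derivative of
    \<open>v'\<close> both contributions are \<open>- f z / 2\<close>, which gives
    \<open>v z - f z\<close>.\<close>
  have dv: "(v has_real_derivative v' z) (at z within {a..b})" if "z \<in> {a..b}" for z
    unfolding v_def v'_def
    by (rule derivative_eq_intros dP dQ that refl)+ (simp add: algebra_simps ee ee')
  have dv': "(v' has_real_derivative v z - f z) (at z within {a..b})" if "z \<in> {a..b}" for z
    unfolding v_def v'_def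
    by (rule derivative_eq_intros dP dQ that refl)+ (simp add: algebra_simps ee ee' exp_minus_inverse)
  have v: "kernel_op a b K f z = v z" if z: "z \<in> {a..b}" for z
  proof -
    let ?h = "\<lambda>y. K z y * f y"
    have i: "?h integrable_on {a..b}" unfolding K_def
      by (rule integrable_continuous_interval) (intro continuous_intros f ballI, simp)
    have iP: "(\<lambda>y. exp y * f y) integrable_on {c..d}" 
      and iQ: "(\<lambda>y. exp (- y) * f y) integrable_on {c..d}" if "{c..d} \<subseteq> {a..b}" for c d
      by (intro integrable_continuous_interval continuous_on_subset[OF ce(1) that]
          continuous_on_subset[OF ce(2) that])+
    have s: "{a..z} \<subseteq> {a..b}" "{z..b} \<subseteq> {a..b}" using z by auto
    note iP = iP[OF s(1)] iP[OF s(2)] and iQ = iQ[OF s(1)] iQ[OF s(2)]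
    \<comment> \<open>The terms with \<open>p\<close> and \<open>q\<close> carry integrals over the
      whole interval, so \<open>A\<close> and \<open>B\<close> are split at \<open>z\<close> to
      match the two halves of the kernel integral.\<close>
    have A: "A = ?P z + integral {z..b} (\<lambda>y. exp y * f y)"
      unfolding A_def using z
      by (intro Henstock_Kurzweil_Integration.integral_combine[symmetric] integrable_continuous_interval ce) auto
    have B: "B = integral {a..z} (\<lambda>y. exp (- y) * f y) + ?Q z"
      unfolding B_def using z
      by (intro Henstock_Kurzweil_Integration.integral_combine[symmetric] integrable_continuous_interval ce) auto
    have "kernel_op a b K f z = integral {a..b} ?h"
      unfolding K_def by (intro kernel_op_eq_integral continuous_intros f ballI, simp)
    also have "\<dots> = integral {a..z} ?h + integral {z..b} ?h"
      using z i by (intro Henstock_Kurzweil_Integration.integral_combine[symmetric]) auto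
    also have "integral {a..z} ?h = integral {a..z} (\<lambda>y. (1/2 * exp (- z) - p * exp z) * (exp y * f y)
        + (- q * exp (- z)) * (exp (- y) * f y))"
      by (intro integral_cong)
        (auto simp: K_def field_simps exp_add exp_diff exp_minus)
    also have "\<dots> = (1/2 * exp (- z) - p * exp z) * ?P z
        + (- q * exp (- z)) * integral {a..z} (\<lambda>y. exp (- y) * f y)"
      by (subst Henstock_Kurzweil_Integration.integral_add)
        (intro integrable_on_mult_right iP iQ | simp only: Henstock_Kurzweil_Integration.integral_mult_right)+
    also have "integral {z..b} ?h = integral {z..b} (\<lambda>y. - p * exp z * (exp y * f y)
        + (1/2 * exp z - q * exp (- z)) * (exp (- y) * f y))"
      by (intro integral_cong)
        (auto simp: K_def field_simps exp_add exp_diff exp_minus)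
    also have "\<dots> = - p * exp z * integral {z..b} (\<lambda>y. exp y * f y)
        + (1/2 * exp z - q * exp (- z)) * ?Q z"
      by (subst Henstock_Kurzweil_Integration.integral_add)
        (intro integrable_on_mult_right iP iQ | simp only: Henstock_Kurzweil_Integration.integral_mult_right)+
    finally show ?thesis
      unfolding v_def A B by (simp add: algebra_simps)
  qed
  have ends: "L (v a) (v' a)" "R (v b) (v' b)"
    using L[of B A] R[of A B] by (simp_all add: v_def v'_def A_def B_def algebra_simps)
  show "solves_bvp a b L R f (kernel_op a b K f)"
    unfolding solves_bvp_def
  proof (intro exI conjI ballI)
    fix z assume z: "z \<in> {a..b}"
    show "(kernel_op a b K f has_real_derivative v' z) (at z within {a..b})"
      by (rule has_field_derivative_transform_within[OF dv[OF z] zero_less_one z]) (simp add: v)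
    show "(v' has_real_derivative v z - f z) (at z within {a..b})"
      by (rule dv'[OF z])
  qed (use ab ends in \<open>simp_all add: v\<close>)
qed

section \<open>Zero solutions of homogeneous equations\<close>

text \<open>The integrating factor \<open>exp (- c * x)\<close> makes the product with
  \<open>w\<close> constant, and the zero at \<open>x0\<close> fixes the constant.\<close>

lemma linear_ode_zero:
  fixes w :: "real \<Rightarrow> real"
  assumes w: "\<And>x. x \<in> {a..b} \<Longrightarrow> (w has_real_derivative c * w x) (at x within {a..b})"
    and "x0 \<in> {a..b}" "w x0 = 0" and x: "x \<in> {a..b}"
  shows "w x = 0"
proof -
  have "((\<lambda>x. w x * exp (- c * x)) has_real_derivative 0) (at x within {a..b})"
    if "x \<in> {a..b}" for x
    by (rule derivative_eq_intros w that refl)+ (simp add: algebra_simps)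
  then obtain k where "\<forall>x\<in>{a..b}. w x * exp (- c * x) = k"
    using has_field_derivative_zero_constant[of "{a..b}" "\<lambda>x. w x * exp (- c * x)"] by auto
  with assms have "w x * exp (- c * x) = 0"
    by (metis mult_zero_left)
  then show ?thesis by simp
qed

text \<open>The combination \<open>c w - w'\<close> satisfies a first order equation, so it vanishes once it does
  at one point, and then \<open>w\<close> itself satisfies \<open>w' = c w\<close>.\<close>

lemma second_order_ode_zero:
  fixes w w' :: "real \<Rightarrow> real"
  assumes w: "\<And>x. x \<in> {a..b} \<Longrightarrow> (w has_real_derivative w' x) (at x within {a..b})"
    and w': "\<And>x. x \<in> {a..b} \<Longrightarrow> (w' has_real_derivative w x) (at x within {a..b})"
    and c: "c\<^sup>2 = 1"
    and "x0 \<in> {a..b}" "w' x0 = c * w x0" "x1 \<in> {a..b}" "w x1 = 0" "x \<in> {a..b}"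
  shows "w x = 0"
proof -
  have cc: "c * (c * t) = t" for t
    using c by (simp add: power2_eq_square flip: mult.assoc)
  have d: "((\<lambda>x. c * w x - w' x) has_real_derivative (- c) * (c * w x - w' x)) (at x within {a..b})"
    if "x \<in> {a..b}" for x
    by (rule derivative_eq_intros w w' that refl)+ (simp add: algebra_simps cc)
  have "w' x = c * w x" if "x \<in> {a..b}" for x
    using linear_ode_zero[OF d \<open>x0 \<in> _\<close> _ that] assms by auto
  then show ?thesis
    using linear_ode_zero[of a b w c, OF _ \<open>x1 \<in> _\<close> \<open>w x1 = 0\<close> \<open>x \<in> _\<close>] w by auto
qed

section \<open>The quadratic form of a factored kernel\<close>

text \<open>Write \<open>g s\<close> for the integral of \<open>\<phi> s z * f z\<close> over
  \<open>z\<close>. Exchanging the integrals over \<open>s\<close> and \<open>y\<close> at fixed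
  \<open>z\<close> produces one factor \<open>g s\<close>; exchanging those over \<open>s\<close>
  and \<open>z\<close> produces the second.\<close>

lemma (in finite_measure) quadratic_form_factored_kernel:
  fixes \<phi> :: "'a \<Rightarrow> 'a \<Rightarrow> real"
  assumes \<phi>[measurable]: "case_prod \<phi> \<in> borel_measurable (M \<Otimes>\<^sub>M M)"
    and bnd: "\<And>s z. \<bar>\<phi> s z\<bar> \<le> 1" and f: "integrable M f"
  shows "(\<integral>z. f z * (\<integral>y. (\<integral>s. \<phi> s z * \<phi> s y \<partial>M) * f y \<partial>M) \<partial>M) = (\<integral>s. (\<integral>z. \<phi> s z * f z \<partial>M)\<^sup>2 \<partial>M)"
proof -
  interpret P: pair_sigma_finite M M ..
  have [measurable]: "f \<in> borel_measurable M" using f by simp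
  define g where "g s = (\<integral>z. \<phi> s z * f z \<partial>M)" for s
  have [measurable]: "g \<in> borel_measurable M" unfolding g_def by measurable
  \<comment> \<open>Both exchanges rest on a majorant \<open>C * \<bar>f y\<bar>\<close> that is
    constant in \<open>s\<close>; it is integrable on the product because \<open>M\<close> is
    finite.\<close>
  have pint: "integrable (M \<Otimes>\<^sub>M M) (case_prod k)"
    if [measurable]: "case_prod k \<in> borel_measurable (M \<Otimes>\<^sub>M M)"
      and k: "\<And>s y. s \<in> space M \<Longrightarrow> y \<in> space M \<Longrightarrow> \<bar>k s y\<bar> \<le> C * \<bar>f y\<bar>" for k C
  proof (rule Bochner_Integration.integrable_bound)
    show "integrable (M \<Otimes>\<^sub>M M) (\<lambda>(s, y). C * \<bar>f y\<bar>)"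
      by (rule P.Fubini_integrable) (auto intro!: f integrable_abs)
    show "AE x in M \<Otimes>\<^sub>M M. norm (case_prod k x) \<le> norm (case x of (s, y) \<Rightarrow> C * \<bar>f y\<bar>)"
    proof (rule AE_I2)
      fix x assume "x \<in> space (M \<Otimes>\<^sub>M M)"
      then show "norm (case_prod k x) \<le> norm (case x of (s, y) \<Rightarrow> C * \<bar>f y\<bar>)"
        using k[of "fst x" "snd x"] by (auto simp: space_pair_measure)
    qed
  qed measurable
  have b1: "\<bar>\<phi> s z * t\<bar> \<le> \<bar>t\<bar>" for s z t
    using mult_right_mono[OF bnd[of s z], of "\<bar>t\<bar>"] by (simp add: abs_mult)
  have inner: "(\<integral>y. (\<integral>s. \<phi> s z * \<phi> s y \<partial>M) * f y \<partial>M) = (\<integral>s. \<phi> s z * g s \<partial>M)"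
    if [measurable]: "z \<in> space M" for z
  proof -
    have "(\<integral>y. (\<integral>s. \<phi> s z * \<phi> s y \<partial>M) * f y \<partial>M) = (\<integral>y. (\<integral>s. \<phi> s z * (\<phi> s y * f y) \<partial>M) \<partial>M)"
      by (simp add: mult.assoc flip: integral_mult_left_zero)
    also have "\<dots> = (\<integral>s. (\<integral>y. \<phi> s z * (\<phi> s y * f y) \<partial>M) \<partial>M)"
    proof (rule P.Fubini_integral, rule pint[where C = 1])
      show "\<bar>\<phi> s z * (\<phi> s y * f y)\<bar> \<le> 1 * \<bar>f y\<bar>" for s y
        using b1[of s z "\<phi> s y * f y"] b1[of s y "f y"] by simp
    qed measurable
    also have "\<dots> = (\<integral>s. \<phi> s z * g s \<partial>M)"
      by (simp add: g_def)
    finally show ?thesis .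
  qed
  \<comment> \<open>The second exchange carries the factor \<open>g s\<close>, and this bound
    supplies the constant \<open>C\<close> of its majorant.\<close>
  have g_le: "\<bar>g s\<bar> \<le> (\<integral>z. \<bar>f z\<bar> \<partial>M)" if [measurable]: "s \<in> space M" for s
  proof -
    have i: "integrable M (\<lambda>z. \<phi> s z * f z)"
      by (rule Bochner_Integration.integrable_bound[OF f]) (use b1 in auto)
    have "\<bar>g s\<bar> \<le> (\<integral>z. \<bar>\<phi> s z * f z\<bar> \<partial>M)"
      unfolding g_def by (rule integral_abs_bound)
    also have "\<dots> \<le> (\<integral>z. \<bar>f z\<bar> \<partial>M)"
      by (intro integral_mono integrable_abs i f b1)
    finally show ?thesis .
  qed
  have "(\<integral>z. f z * (\<integral>y. (\<integral>s. \<phi> s z * \<phi> s y \<partial>M) * f y \<partial>M) \<partial>M) = (\<integral>z. (\<integral>s. g s * (\<phi> s z * f z) \<partial>M) \<partial>M)"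
  proof (rule Bochner_Integration.integral_cong[OF refl])
    fix z assume z: "z \<in> space M"
    show "f z * (\<integral>y. (\<integral>s. \<phi> s z * \<phi> s y \<partial>M) * f y \<partial>M) = (\<integral>s. g s * (\<phi> s z * f z) \<partial>M)"
      unfolding inner[OF z] by (simp add: mult_ac flip: integral_mult_right_zero)
  qed
  also have "\<dots> = (\<integral>s. (\<integral>z. g s * (\<phi> s z * f z) \<partial>M) \<partial>M)"
  proof (rule P.Fubini_integral, rule pint[where C = "\<integral>z. \<bar>f z\<bar> \<partial>M"])
    show "\<bar>g s * (\<phi> s y * f y)\<bar> \<le> (\<integral>z. \<bar>f z\<bar> \<partial>M) * \<bar>f y\<bar>" if "s \<in> space M" for s y
      unfolding abs_mult[of "g s"] by (intro mult_mono g_le b1 that) auto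
  qed measurable
  also have "\<dots> = (\<integral>s. (g s)\<^sup>2 \<partial>M)"
    by (simp add: g_def power2_eq_square)
  finally show ?thesis unfolding g_def .
qed

section \<open>Functions with vanishing indefinite integrals\<close>

text \<open>The positive and negative parts of \<open>h\<close> are densities of two finite measures
  that agree on all half-lines, hence everywhere. The two parts then coincide almost everywhere, and
  since at each point one of them is zero, so is \<open>h\<close>.\<close>

lemma AE_zero_if_integral_greaterThan_zero:
  fixes h :: "real \<Rightarrow> real"
  assumes h: "integrable lborel h" and 0: "\<And>s. (LBINT x:{s<..}. h x) = 0"
  shows "AE x in lborel. h x = 0"
proof -
  have [measurable]: "h \<in> borel_measurable borel" using h by simp
  have i: "set_integrable lborel {s<..} (\<lambda>x. max 0 (k x))" if k: "integrable lborel k"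
    for k :: "real \<Rightarrow> real" and s
    unfolding set_integrable_def by (intro integrable_mult_indicator) (use k in auto)
  have e: "emeasure (density lborel (\<lambda>x. ennreal (max 0 (k x)))) {s<..}
      = ennreal (LBINT x:{s<..}. max 0 (k x))" if k: "integrable lborel k" for k :: "real \<Rightarrow> real" and s
  proof -
    have [measurable]: "k \<in> borel_measurable borel" using k by simp
    have "integrable lborel (\<lambda>x. indicator {s<..} x * max 0 (k x))"
      using i[OF k] by (simp add: set_integrable_def)
    then show ?thesis
      by (subst emeasure_density)
        (auto simp: set_lebesgue_integral_def nn_integral_eq_integral[symmetric] ennreal_mult'
          ennreal_indicator mult.commute intro!: nn_integral_cong split: split_indicator)
  qed
  have "density lborel (\<lambda>x. ennreal (max 0 (h x))) = density lborel (\<lambda>x. ennreal (max 0 (- h x)))"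
  proof (rule measure_eqI_lessThan)
    fix s
    have "(LBINT x:{s<..}. max 0 (h x)) - (LBINT x:{s<..}. max 0 (- h x)) = (LBINT x:{s<..}. h x)"
      using h by (subst set_integral_diff(2)[symmetric])
        (auto intro!: i set_lebesgue_integral_cong)
    then show "emeasure (density lborel (\<lambda>x. ennreal (max 0 (h x)))) {s<..}
        = emeasure (density lborel (\<lambda>x. ennreal (max 0 (- h x)))) {s<..}"
      using 0 by (simp add: e h)
    show "emeasure (density lborel (\<lambda>x. ennreal (max 0 (h x)))) {s<..} < \<infinity>"
      by (simp add: e h)
  qed auto
  \<comment> \<open>Recovering densities from equal measures requires a finite total mass.\<close>
  moreover have "(\<integral>\<^sup>+x. ennreal (max 0 (h x)) \<partial>lborel) \<noteq> \<infinity>"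
    using h by (subst nn_integral_eq_integral) auto
  ultimately have "AE x in lborel. ennreal (max 0 (h x)) = ennreal (max 0 (- h x))"
    by (subst (asm) finite_density_unique) auto
  then show ?thesis
    by eventually_elim (auto simp: max_def split: if_splits)
qed


text \<open>Extending \<open>h\<close> by zero outside the interval reduces the claim to
  half-lines.\<close>

lemma AE_zero_if_indefinite_integral_zero:
  fixes h :: "real \<Rightarrow> real"
  assumes h: "set_integrable lborel {a..b} h" and 0: "\<And>s. s \<in> {a..b} \<Longrightarrow> integral {s..b} h = 0"
  shows "AE x\<in>{a..b} in lborel. h x = 0"
proof -
  have "AE x in lborel. indicator {a..b} x * h x = 0"
  proof (rule AE_zero_if_integral_greaterThan_zero)
    show h': "integrable lborel (\<lambda>x. indicator {a..b} x * h x)"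
      using h by (simp add: set_integrable_def)
    fix s
    \<comment> \<open>Inside \<open>{a..b}\<close> the half-line \<open>{s<..}\<close> is
      \<open>{c..b}\<close> up to the null point \<open>s\<close>. If \<open>c\<close> exceeds
      \<open>b\<close>, the integral is over the empty set.\<close>
    define c where "c = max a s"
    have ind: "AE x in lborel. indicat_real {s<..} x * (indicat_real {a..b} x * h x) = indicat_real {c..b} x * h x"
      using AE_lborel_singleton[of s] by eventually_elim (auto simp: c_def split: split_indicator)
    have i: "set_integrable lborel {c..b} h"
      by (rule set_integrable_subset[OF h]) (auto simp: c_def)
    have "(LBINT x:{s<..}. indicator {a..b} x * h x) = (LBINT x:{c..b}. h x)"
      unfolding set_lebesgue_integral_def
    proof (rule integral_cong_AE)
      show "(\<lambda>x. indicat_real {s<..} x *\<^sub>R (indicat_real {a..b} x * h x)) \<in> borel_measurable lborel"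
        by (intro borel_measurable_scaleR borel_measurable_integrable[OF h'] borel_measurable_indicator) simp
      show "(\<lambda>x. indicat_real {c..b} x *\<^sub>R h x) \<in> borel_measurable lborel"
        using i unfolding set_integrable_def by (rule borel_measurable_integrable)
    qed (use ind in simp)
    also have "\<dots> = integral {c..b} h"
      by (rule set_borel_integral_eq_integral(2)[OF i])
    also have "\<dots> = 0"
      using 0[of c] by (cases "c \<le> b") (auto simp: c_def)
    finally show "(LBINT x:{s<..}. indicator {a..b} x * h x) = 0" .
  qed
  then show ?thesis
    by eventually_elim (auto split: split_indicator)
qed

section \<open>Positive definiteness from a factorisation\<close>

text \<open>The form is the integral of the square of \<open>g s\<close>, the transform of
  \<open>f\<close> by \<open>\<phi>\<close>. Continuity of the transform (\<open>cont\<close>) turns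
  a zero integral into a zero transform, and \<open>inj\<close> then gives \<open>f = 0\<close>
  almost everywhere.\<close>

lemma positive_definite_kernel_factored:
  fixes \<phi> :: "real \<Rightarrow> real \<Rightarrow> real"
  assumes ab: "a < b"
    and \<phi>: "case_prod \<phi> \<in> borel_measurable (borel \<Otimes>\<^sub>M borel)" and bnd: "\<And>s z. \<bar>\<phi> s z\<bar> \<le> 1"
    and K: "\<And>z y. z \<in> {a..b} \<Longrightarrow> y \<in> {a..b} \<Longrightarrow> K z y = (LBINT s:{a..b}. \<phi> s z * \<phi> s y)"
    and cont: "\<And>f. set_integrable lborel {a..b} f \<Longrightarrow>
        continuous_on {a..b} (\<lambda>s. LBINT z:{a..b}. \<phi> s z * f z)"
    and inj: "\<And>f. set_integrable lborel {a..b} f \<Longrightarrow>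
        (\<And>s. s \<in> {a..b} \<Longrightarrow> (LBINT z:{a..b}. \<phi> s z * f z) = 0) \<Longrightarrow> AE z\<in>{a..b} in lborel. f z = 0"
  shows "positive_definite_kernel a b K"
  unfolding positive_definite_kernel_def
proof (intro allI impI, elim conjE)
  fix f :: "real \<Rightarrow> real"
  assume fm: "set_borel_measurable lborel {a..b} f"
    and f2: "set_integrable lborel {a..b} (\<lambda>z. (f z)\<^sup>2)"
    and nz: "\<not> (AE z\<in>{a..b} in lborel. f z = 0)"
  have f: "set_integrable lborel {a..b} f"
  proof (rule set_integrable_bound[OF _ fm])
    show "set_integrable lborel {a..b} (\<lambda>z. 1 + (f z)\<^sup>2)"
      by (intro set_integral_add f2 borel_integrable_atLeastAtMost' continuous_intros)
    \<comment> \<open>This places square integrable functions on a bounded interval among the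
      integrable ones, as the exchange of integrals demands.\<close>
    have "\<bar>t\<bar> \<le> 1 + t\<^sup>2" for t :: real
      using zero_le_power2[of "\<bar>t\<bar> - 1/2"] by (simp add: power2_eq_square algebra_simps)
    then show "AE x in lborel. x \<in> {a..b} \<longrightarrow> norm (f x) \<le> norm (1 + (f x)\<^sup>2)"
      by (intro AE_I2) (simp add: abs_of_nonneg add_nonneg_nonneg)
  qed
  define M where "M = restrict_space lborel {a..b}"
  interpret finite_measure M
    unfolding M_def by (rule finite_measureI) (use emeasure_lborel_Icc_eq[of a b] in \<open>simp add: emeasure_restrict_space space_restrict_space\<close>)
  have LM: "(LBINT x:{a..b}. k x) = (\<integral>x. k x \<partial>M)" for k :: "real \<Rightarrow> real"
    unfolding M_def set_lebesgue_integral_def by (subst integral_restrict_space) auto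
  have spM: "space M = {a..b}" by (simp add: M_def space_restrict_space)
  have id: "(\<lambda>x. x) \<in> measurable M borel"
    unfolding M_def by (rule measurable_restrict_space1) simp
  have "(\<lambda>x. (fst x, snd x)) \<in> measurable (M \<Otimes>\<^sub>M M) (borel \<Otimes>\<^sub>M borel)"
    by (intro measurable_Pair measurable_compose[OF measurable_fst id] measurable_compose[OF measurable_snd id])
  from measurable_compose[OF this \<phi>] have \<phi>M: "case_prod \<phi> \<in> borel_measurable (M \<Otimes>\<^sub>M M)"
    by (simp add: case_prod_beta)
  have fM: "integrable M f"
    using f unfolding M_def set_integrable_def by (subst integrable_restrict_space) auto
  define g where "g s = (LBINT z:{a..b}. \<phi> s z * f z)" for s
  have cg: "continuous_on {a..b} (\<lambda>s. (g s)\<^sup>2)"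
    unfolding g_def by (intro continuous_intros cont f)
  have "(LBINT z:{a..b}. f z * kernel_op a b K f z)
      = (\<integral>z. f z * (\<integral>y. (\<integral>s. \<phi> s z * \<phi> s y \<partial>M) * f y \<partial>M) \<partial>M)"
    unfolding LM kernel_op_def
    by (intro Bochner_Integration.integral_cong refl arg_cong2[of _ _ _ _ "(*)"])
      (simp_all add: K LM spM)
  also have "\<dots> = (LBINT s:{a..b}. (g s)\<^sup>2)"
    unfolding g_def LM by (rule quadratic_form_factored_kernel[OF \<phi>M bnd fM])
  also have "\<dots> = integral {a..b} (\<lambda>s. (g s)\<^sup>2)"
    by (intro set_borel_integral_eq_integral borel_integrable_atLeastAtMost' cg)
  also have "\<dots> > 0"
  proof -
    have "integral {a..b} (\<lambda>s. (g s)\<^sup>2) \<noteq> 0"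
      using inj[OF f] nz integral_eq_0_iff[OF cg ab] by (auto simp: g_def)
    moreover have "integral {a..b} (\<lambda>s. (g s)\<^sup>2) \<ge> 0"
      by (intro Henstock_Kurzweil_Integration.integral_nonneg integrable_continuous_interval cg) auto
    ultimately show ?thesis by simp
  qed
  finally show "(LBINT z:{a..b}. f z * kernel_op a b K f z) > 0" .
qed

section \<open>Factorisations of the two child kernels\<close>

lemma set_integrable_exp_mult:
  fixes f :: "real \<Rightarrow> real"
  assumes "set_integrable lborel {a..b} f"
  shows "set_integrable lborel {a..b} (\<lambda>z. exp (c * z) * f z)"
proof -
  define C where "C = exp (\<bar>c\<bar> * max \<bar>a\<bar> \<bar>b\<bar>)"
  show ?thesis
  proof (rule set_integrable_bound)
    show "set_integrable lborel {a..b} (\<lambda>z. C * f z)"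
      using assms by simp
    have "(\<lambda>x. exp (c * x) * (indicat_real {a..b} x * f x)) \<in> borel_measurable lborel"
      using borel_measurable_times[OF _ borel_measurable_integrable[OF assms[unfolded set_integrable_def]],
          of "\<lambda>x. exp (c * x)"] by simp
    then show "set_borel_measurable lborel {a..b} (\<lambda>z. exp (c * z) * f z)"
      by (simp only: set_borel_measurable_def real_scaleR_def mult.left_commute)
    have "exp (c * x) \<le> C" if "x \<in> {a..b}" for x
    proof -
      have "c * x \<le> \<bar>c\<bar> * \<bar>x\<bar>" by (simp add: abs_mult[symmetric])
      also have "\<dots> \<le> \<bar>c\<bar> * max \<bar>a\<bar> \<bar>b\<bar>" using that by (intro mult_left_mono) auto
      finally show ?thesis by (simp add: C_def)
    qed
    then show "AE x in lborel. x \<in> {a..b} \<longrightarrow> norm (exp (c * x) * f x) \<le> norm (C * f x)"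
      by (intro AE_I2) (auto simp: abs_mult C_def intro!: mult_right_mono)
  qed
qed

lemma has_integral_exp_affine:
  fixes c d l u :: real
  assumes "l \<le> u" "d \<noteq> 0"
  shows "((\<lambda>s. exp (c + d * s)) has_integral (exp (c + d * u) - exp (c + d * l)) / d) {l..u}"
proof -
  have "((\<lambda>s. exp (c + d * s)) has_integral exp (c + d * u) / d - exp (c + d * l) / d) {l..u}"
    using assms by (intro fundamental_theorem_of_calculus)
      (auto intro!: derivative_eq_intros simp flip: has_real_derivative_iff_has_vector_derivative)
  then show ?thesis by (simp add: diff_divide_distrib)
qed

lemma set_integral_if:
  fixes k :: "real \<Rightarrow> real"
  shows "(LBINT s:A. (if P s then k s else 0)) = (LBINT s:{s \<in> A. P s}. k s)"
  unfolding set_lebesgue_integral_def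
  by (rule Bochner_Integration.integral_cong) (auto split: split_indicator)

text \<open>The product of two factors is \<open>exp (z + y - 2 * s)\<close> on
  \<open>{max z y..b}\<close>. Its integral has the term
  \<open>exp (- \<bar>z - y\<bar>) / 2\<close> from the lower limit, because
  \<open>z + y - 2 * max z y = - \<bar>z - y\<bar>\<close>, and the subtracted term from the upper
  limit \<open>b\<close>.\<close>

lemma positive_definite_left_kernel:
  assumes "a < b"
  shows "positive_definite_kernel a b (\<lambda>z y. exp (- \<bar>z - y\<bar>) / 2 - exp (- 2 * b) / 2 * exp (z + y))"
proof (rule positive_definite_kernel_factored[where \<phi> = "\<lambda>s z. if z \<le> s then exp (z - s) else 0"])
  have g: "(LBINT z:{a..b}. (if z \<le> s then exp (z - s) else 0) * f z)
      = exp (- s) * integral {a..s} (\<lambda>z. exp (1 * z) * f z)"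
    if f: "set_integrable lborel {a..b} f" and s: "s \<in> {a..b}" for f s
  proof -
    have "(LBINT z:{a..b}. (if z \<le> s then exp (z - s) else 0) * f z)
        = (LBINT z:{a..b}. (if z \<le> s then exp (- s) * (exp (1 * z) * f z) else 0))"
      by (intro set_lebesgue_integral_cong) (auto simp: exp_diff exp_minus field_simps)
    also have "\<dots> = (LBINT z:{a..s}. exp (- s) * (exp (1 * z) * f z))"
      unfolding set_integral_if using s by (intro arg_cong2[of _ _ _ _ "set_lebesgue_integral lborel"]) auto
    also have "\<dots> = exp (- s) * (LBINT z:{a..s}. exp (1 * z) * f z)"
      by simp
    also have "(LBINT z:{a..s}. exp (1 * z) * f z) = integral {a..s} (\<lambda>z. exp (1 * z) * f z)"
      using s by (intro set_borel_integral_eq_integral set_integrable_exp_mult set_integrable_subset[OF f]) auto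
    finally show ?thesis .
  qed
  fix f :: "real \<Rightarrow> real" assume f: "set_integrable lborel {a..b} f"
  note ef = set_integrable_exp_mult[OF f, of 1]
  note int = set_borel_integral_eq_integral(1)[OF ef]
  show "continuous_on {a..b} (\<lambda>s. LBINT z:{a..b}. (if z \<le> s then exp (z - s) else 0) * f z)"
    by (subst continuous_on_cong[OF refl g[OF f]], assumption)
      (intro continuous_intros indefinite_integral_continuous_1 int)
  assume 0: "(LBINT z:{a..b}. (if z \<le> s then exp (z - s) else 0) * f z) = 0" if "s \<in> {a..b}" for s
  have z: "integral {a..s} (\<lambda>z. exp (1 * z) * f z) = 0" if "s \<in> {a..b}" for s
    using 0[OF that] g[OF f that] by simp
  \<comment> \<open>The transform controls integrals from \<open>a\<close> to \<open>s\<close>.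
    Those from \<open>s\<close> to \<open>b\<close>, used in the criterion, are differences with the
    full integral.\<close>
  have "integral {s..b} (\<lambda>z. exp (1 * z) * f z) = 0" if "s \<in> {a..b}" for s
    using Henstock_Kurzweil_Integration.integral_combine[where a = a and b = b and c = s, OF _ _ int] z[OF that] z[of b] that by auto
  from AE_zero_if_indefinite_integral_zero[OF ef this]
  show "AE z\<in>{a..b} in lborel. f z = 0" by simp
next
  fix z y :: real assume zy: "z \<in> {a..b}" "y \<in> {a..b}"
  define m where "m = max z y"
  have "(LBINT s:{a..b}. (if z \<le> s then exp (z - s) else 0) * (if y \<le> s then exp (y - s) else 0))
      = (LBINT s:{a..b}. if m \<le> s then exp (z + y + - 2 * s) else 0)"
    by (intro set_lebesgue_integral_cong) (auto simp: m_def simp flip: exp_add)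
  also have "\<dots> = (LBINT s:{m..b}. exp (z + y + - 2 * s))"
    unfolding set_integral_if using zy
    by (intro arg_cong2[of _ _ _ _ "set_lebesgue_integral lborel"]) (auto simp: m_def)
  also have "\<dots> = integral {m..b} (\<lambda>s. exp (z + y + - 2 * s))"
    by (intro set_borel_integral_eq_integral borel_integrable_atLeastAtMost' continuous_intros)
  also have "\<dots> = (exp (z + y + - 2 * b) - exp (z + y + - 2 * m)) / - 2"
    using zy by (intro integral_unique has_integral_exp_affine) (auto simp: m_def)
  also have "\<dots> = exp (z + y + - 2 * m) / 2 - exp (z + y + - 2 * b) / 2"
    by (simp add: field_simps)
  also have "z + y + - 2 * m = - \<bar>z - y\<bar>"
    by (simp add: m_def max_def)
  finally show "exp (- \<bar>z - y\<bar>) / 2 - exp (- 2 * b) / 2 * exp (z + y) =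
      (LBINT s:{a..b}. (if z \<le> s then exp (z - s) else 0) * (if y \<le> s then exp (y - s) else 0))"
    by (simp add: exp_add exp_diff exp_minus field_simps)
qed (use assms in \<open>auto simp: case_prod_beta\<close>)

text \<open>Mirror image of the left child: the product of factors lives on
  \<open>{a..min z y}\<close>, the upper limit yields \<open>exp (- \<bar>z - y\<bar>) / 2\<close>
  and the lower limit \<open>a\<close> the subtracted term. Here the transform already involves
  integrals from \<open>s\<close> to \<open>b\<close>.\<close>

lemma positive_definite_right_kernel:
  assumes "a < b"
  shows "positive_definite_kernel a b (\<lambda>z y. exp (- \<bar>z - y\<bar>) / 2 - exp (2 * a) / 2 * exp (- z - y))"
proof (rule positive_definite_kernel_factored[where \<phi> = "\<lambda>s z. if s \<le> z then exp (s - z) else 0"])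
  have g: "(LBINT z:{a..b}. (if s \<le> z then exp (s - z) else 0) * f z)
      = exp s * integral {s..b} (\<lambda>z. exp (- 1 * z) * f z)"
    if f: "set_integrable lborel {a..b} f" and s: "s \<in> {a..b}" for f s
  proof -
    have "(LBINT z:{a..b}. (if s \<le> z then exp (s - z) else 0) * f z)
        = (LBINT z:{a..b}. (if s \<le> z then exp s * (exp (- 1 * z) * f z) else 0))"
      by (intro set_lebesgue_integral_cong) (auto simp: exp_diff exp_minus field_simps)
    also have "\<dots> = (LBINT z:{s..b}. exp s * (exp (- 1 * z) * f z))"
      unfolding set_integral_if using s by (intro arg_cong2[of _ _ _ _ "set_lebesgue_integral lborel"]) auto
    also have "\<dots> = exp s * (LBINT z:{s..b}. exp (- 1 * z) * f z)"
      by simp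
    also have "(LBINT z:{s..b}. exp (- 1 * z) * f z) = integral {s..b} (\<lambda>z. exp (- 1 * z) * f z)"
      using s by (intro set_borel_integral_eq_integral set_integrable_exp_mult set_integrable_subset[OF f]) auto
    finally show ?thesis .
  qed
  fix f :: "real \<Rightarrow> real" assume f: "set_integrable lborel {a..b} f"
  note ef = set_integrable_exp_mult[OF f, of "- 1"]
  note int = set_borel_integral_eq_integral(1)[OF ef]
  show "continuous_on {a..b} (\<lambda>s. LBINT z:{a..b}. (if s \<le> z then exp (s - z) else 0) * f z)"
    by (subst continuous_on_cong[OF refl g[OF f]], assumption)
      (intro continuous_intros indefinite_integral_continuous_1' int)
  assume 0: "(LBINT z:{a..b}. (if s \<le> z then exp (s - z) else 0) * f z) = 0" if "s \<in> {a..b}" for s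
  have "integral {s..b} (\<lambda>z. exp (- 1 * z) * f z) = 0" if "s \<in> {a..b}" for s
    using 0[OF that] g[OF f that] by simp
  from AE_zero_if_indefinite_integral_zero[OF ef this]
  show "AE z\<in>{a..b} in lborel. f z = 0" by simp
next
  fix z y :: real assume zy: "z \<in> {a..b}" "y \<in> {a..b}"
  define m where "m = min z y"
  have "(LBINT s:{a..b}. (if s \<le> z then exp (s - z) else 0) * (if s \<le> y then exp (s - y) else 0))
      = (LBINT s:{a..b}. if s \<le> m then exp (- z - y + 2 * s) else 0)"
    by (intro set_lebesgue_integral_cong) (auto simp: m_def simp flip: exp_add)
  also have "\<dots> = (LBINT s:{a..m}. exp (- z - y + 2 * s))"
    unfolding set_integral_if using zy
    by (intro arg_cong2[of _ _ _ _ "set_lebesgue_integral lborel"]) (auto simp: m_def)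
  also have "\<dots> = integral {a..m} (\<lambda>s. exp (- z - y + 2 * s))"
    by (intro set_borel_integral_eq_integral borel_integrable_atLeastAtMost' continuous_intros)
  also have "\<dots> = (exp (- z - y + 2 * m) - exp (- z - y + 2 * a)) / 2"
    using zy by (intro integral_unique has_integral_exp_affine) (auto simp: m_def)
  also have "- z - y + 2 * m = - \<bar>z - y\<bar>"
    by (simp add: m_def min_def)
  finally show "exp (- \<bar>z - y\<bar>) / 2 - exp (2 * a) / 2 * exp (- z - y) =
      (LBINT s:{a..b}. (if s \<le> z then exp (s - z) else 0) * (if s \<le> y then exp (s - y) else 0))"
    by (simp add: exp_add exp_diff exp_minus field_simps)
qed (use assms in \<open>auto simp: case_prod_beta\<close>)

section \<open>Uniqueness for the child problems and subtraction of an exponential\<close>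

text \<open>The difference of two solutions satisfies \<open>w'' = w\<close> with homogeneous
  conditions. The outer condition reads \<open>w' = c * w\<close> with \<open>c = 1\<close> at the
  left end or \<open>c = - 1\<close> at the right end, and the other end supplies the zero of
  \<open>w\<close>.\<close>

lemma solves_bvp_unique:
  assumes u: "solves_bvp a b L R f u" and v: "solves_bvp a b L R f v"
    and LR: "L = bc_left \<and> R = bc_zero \<or> L = bc_zero \<and> R = bc_right"
    and x: "x \<in> {a..b}"
  shows "u x = v x"
proof -
  obtain u' u'' where u: "\<And>z. z \<in> {a..b} \<Longrightarrow> (u has_real_derivative u' z) (at z within {a..b})"
    "\<And>z. z \<in> {a..b} \<Longrightarrow> (u' has_real_derivative u'' z) (at z within {a..b})"
    "\<And>z. z \<in> {a..b} \<Longrightarrow> u z - u'' z = f z" "L (u a) (u' a)" "R (u b) (u' b)"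
    using u unfolding solves_bvp_def by blast
  obtain v' v'' where v: "\<And>z. z \<in> {a..b} \<Longrightarrow> (v has_real_derivative v' z) (at z within {a..b})"
    "\<And>z. z \<in> {a..b} \<Longrightarrow> (v' has_real_derivative v'' z) (at z within {a..b})"
    "\<And>z. z \<in> {a..b} \<Longrightarrow> v z - v'' z = f z" "L (v a) (v' a)" "R (v b) (v' b)"
    using v unfolding solves_bvp_def by blast
  define w w' where "w x = u x - v x" and "w' x = u' x - v' x" for x
  have w: "(w has_real_derivative w' x) (at x within {a..b})"
    and w': "(w' has_real_derivative w x) (at x within {a..b})" if "x \<in> {a..b}" for x
    unfolding w_def w'_def using u(3)[OF that] v(3)[OF that]
    by (auto intro!: derivative_eq_intros u(1,2) v(1,2) that)
  have ab: "a \<in> {a..b}" "b \<in> {a..b}" using x by auto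
  have "w x = 0"
    using LR
  proof
    assume "L = bc_left \<and> R = bc_zero"
    with u(4,5) v(4,5) show ?thesis
      using second_order_ode_zero[OF w w', of 1 a b x] ab x
      by (simp add: w_def w'_def bc_left_def bc_zero_def)
  next
    assume "L = bc_zero \<and> R = bc_right"
    with u(4,5) v(4,5) show ?thesis
      using second_order_ode_zero[OF w w', of "- 1" b a x] ab x
      by (simp add: w_def w'_def bc_right_def bc_zero_def)
  qed
  then show ?thesis by (simp add: w_def)
qed

text \<open>With \<open>e\<close> equal to 1 or -1 the exponential solves the homogeneous equation,
  so \<open>f\<close> is unchanged. The formula for \<open>v\<close> is asked for on
  \<open>{a..b}\<close> only, because a single layer potential is one exponential on each side of
  \<zeta>. The hypothesis \<open>ends\<close> ranges over all \<open>u'\<close>, since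
  \<open>solves_bvp\<close> hides the derivative behind an existential.\<close>

lemma solves_bvp_diff_exp:
  assumes u: "solves_bvp A B L R f u" and sub: "{a..b} \<subseteq> {A..B}" and ab: "a \<le> b" and e: "e\<^sup>2 = 1"
    and v: "\<And>x. x \<in> {a..b} \<Longrightarrow> v x = u x - k * exp (e * x)"
    and ends: "\<And>u'. L (u A) (u' A) \<Longrightarrow> R (u B) (u' B) \<Longrightarrow>
      L' (u a - k * exp (e * a)) (u' a - e * k * exp (e * a)) \<and>
      R' (u b - k * exp (e * b)) (u' b - e * k * exp (e * b))"
  shows "solves_bvp a b L' R' f v"
proof -
  obtain u' u'' where u: "\<And>z. z \<in> {A..B} \<Longrightarrow> (u has_real_derivative u' z) (at z within {A..B})"
    "\<And>z. z \<in> {A..B} \<Longrightarrow> (u' has_real_derivative u'' z) (at z within {A..B})"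
    "\<And>z. z \<in> {A..B} \<Longrightarrow> u z - u'' z = f z" "L (u A) (u' A)" "R (u B) (u' B)"
    using u unfolding solves_bvp_def by blast
  have ee: "e * (e * t) = t" for t
    using e by (simp add: power2_eq_square flip: mult.assoc)
  show ?thesis
    unfolding solves_bvp_def
  proof (intro exI conjI ballI)
    fix z assume z: "z \<in> {a..b}"
    then have z': "z \<in> {A..B}" using sub by auto
    note d = u(1,2)[OF z', THEN DERIV_subset, OF sub]
    have "((\<lambda>x. u x - k * exp (e * x)) has_real_derivative u' z - e * k * exp (e * z)) (at z within {a..b})"
      by (rule derivative_eq_intros d refl)+ simp
    then show "(v has_real_derivative u' z - e * k * exp (e * z)) (at z within {a..b})"
      by (rule has_field_derivative_transform_within[OF _ zero_less_one z]) (simp add: v)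
    show "((\<lambda>z. u' z - e * k * exp (e * z)) has_real_derivative u'' z - k * exp (e * z)) (at z within {a..b})"
      by (rule derivative_eq_intros d refl)+ (simp add: mult_ac ee)
    show "v z - (u'' z - k * exp (e * z)) = f z"
      using v[OF z] u(3)[OF z'] by simp
  qed (use ends[of u'] u(4,5) v ab in simp_all)
qed

section \<open>The two children of the root\<close>

theorem theorem4p1:
  fixes N :: nat and z :: "nat \<Rightarrow> real" and \<zeta> \<gamma> :: real
  assumes "clustered_locations N z"
    and "between_clusters N z \<zeta>"
    and "\<gamma> = exp (1 - \<zeta>) / sqrt 2"
  shows "is_greens_function 0 \<zeta> bc_left bc_zero (G_l \<gamma>)
       \<and> positive_definite_kernel 0 \<zeta> (G_l \<gamma>)
       \<and> is_greens_function \<zeta> 1 bc_zero bc_right (G_r \<gamma>)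
       \<and> positive_definite_kernel \<zeta> 1 (G_r \<gamma>)
       \<and> (\<forall>f. continuous_on {0..1} f \<longrightarrow>
            solves_bvp 0 1 bc_left bc_right f (kernel_op 0 1 G f) \<and>
            (\<forall>u. solves_bvp 0 1 bc_left bc_right f u \<longrightarrow>
              (\<exists>\<sigma>.
                 solves_bvp 0 \<zeta> bc_left bc_zero f (\<lambda>x. u x - single_layer \<sigma> \<zeta> x) \<and>
                 solves_bvp \<zeta> 1 bc_zero bc_right f (\<lambda>x. u x - single_layer \<sigma> \<zeta> x) \<and>
                 (\<forall>u\<^sub>1. solves_bvp 0 \<zeta> bc_left bc_zero f u\<^sub>1 \<longrightarrow>
                       (\<forall>x\<in>{0..\<zeta>}. u\<^sub>1 x = u x - single_layer \<sigma> \<zeta> x)) \<and>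
                 (\<forall>u\<^sub>2. solves_bvp \<zeta> 1 bc_zero bc_right f u\<^sub>2 \<longrightarrow>
                       (\<forall>x\<in>{\<zeta>..1}. u\<^sub>2 x = u x - single_layer \<sigma> \<zeta> x)))))"
proof -
  \<comment> \<open>Since \<open>N\<close> is even and positive, both clusters are nonempty. This
    puts \<zeta> strictly inside the unit interval, so both child intervals are
    nondegenerate.\<close>
  have "1 \<in> left_child N" "N \<in> right_child N" "z 1 \<in> {0..1}" "z N \<in> {0..1}"
    using assms(1) by (auto simp: clustered_locations_def left_child_def right_child_def elim!: evenE)
  then have \<zeta>: "0 < \<zeta>" "\<zeta> < 1"
    using assms(2) by (fastforce simp: between_clusters_def)+
  \<comment> \<open>As \<open>g_l z * g_l y = exp (z + y - 2)\<close>, the coefficient of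
    \<open>exp (z + y)\<close> in \<open>G_l\<close> becomes
    \<open>exp (- 2 * \<zeta>) / 2\<close>.\<close>
  have \<gamma>: "\<gamma>\<^sup>2 = exp (2 - 2 * \<zeta>) / 2"
    by (simp add: assms(3) power_divide flip: exp_double)
  have Gl: "G_l \<gamma> = (\<lambda>z y. exp (- \<bar>z - y\<bar>) / 2 - exp (- 2 * \<zeta>) / 2 * exp (z + y))"
    by (intro ext) (simp add: G_l_def G_def g_l_def \<gamma> flip: exp_add)
  have \<gamma>': "1 / (4 * \<gamma>\<^sup>2) = exp (2 * \<zeta> - 2) / 2"
    by (simp add: \<gamma> exp_diff field_simps)
  have Gr: "G_r \<gamma> = (\<lambda>z y. exp (- \<bar>z - y\<bar>) / 2 - exp (2 * \<zeta>) / 2 * exp (- z - y))"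
    by (intro ext) (simp only: G_r_def G_def g_r_def \<gamma>', simp flip: exp_add)
  have G: "G = (\<lambda>z y. exp (- \<bar>z - y\<bar>) / 2 - 0 * exp (z + y) - 0 * exp (- z - y))"
    by (intro ext) (simp add: G_def)
  \<comment> \<open>With \<open>q = 0\<close> the value and the derivative at 0 agree for every
    \<open>p\<close>; the chosen \<open>p\<close> annihilates the coefficient of \<open>A\<close> in
    the value at \<zeta>.\<close>
  have 1: "is_greens_function 0 \<zeta> bc_left bc_zero (G_l \<gamma>)"
    using is_greens_function_exp_kernel[of bc_left 0 0 "exp (- 2 * \<zeta>) / 2" bc_zero \<zeta>] \<zeta>
    by (simp add: Gl bc_left_def bc_zero_def flip: exp_add)
  \<comment> \<open>Symmetrically, \<open>p = 0\<close> gives the outer condition at 1 for every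
    \<open>q\<close>, and the chosen \<open>q\<close> annihilates the coefficient of
    \<open>B\<close> in the value at \<zeta>.\<close>
  have 2: "is_greens_function \<zeta> 1 bc_zero bc_right (G_r \<gamma>)"
    using is_greens_function_exp_kernel[of bc_zero \<zeta> "exp (2 * \<zeta>) / 2" 0 bc_right 1] \<zeta>
    by (simp add: Gr bc_right_def bc_zero_def flip: exp_add)
  have 3: "is_greens_function 0 1 bc_left bc_right G"
    unfolding G
    by (rule is_greens_function_exp_kernel) (simp_all add: bc_left_def bc_right_def)
  have 4: "\<exists>\<sigma>. solves_bvp 0 \<zeta> bc_left bc_zero f (\<lambda>x. u x - single_layer \<sigma> \<zeta> x) \<and>
                 solves_bvp \<zeta> 1 bc_zero bc_right f (\<lambda>x. u x - single_layer \<sigma> \<zeta> x)"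
    if u: "solves_bvp 0 1 bc_left bc_right f u" for f u
  proof (intro exI conjI)
    \<comment> \<open>\<open>\<sigma> = u \<zeta> / G \<zeta> \<zeta>\<close>\<close>
    let ?\<sigma> = "2 * u \<zeta>"
    \<comment> \<open>The layer equals \<open>u \<zeta> * exp (x - \<zeta>)\<close> to the left of
      \<zeta> and \<open>u \<zeta> * exp (\<zeta> - x)\<close> to the right, whence the two choices
      of \<open>k\<close> and \<open>e\<close>.\<close>
    show "solves_bvp 0 \<zeta> bc_left bc_zero f (\<lambda>x. u x - single_layer ?\<sigma> \<zeta> x)"
      by (rule solves_bvp_diff_exp[OF u, where k = "u \<zeta> * exp (- \<zeta>)" and e = 1])
        (use \<zeta> in \<open>auto simp: single_layer_def G_def bc_left_def bc_zero_def simp flip: exp_add\<close>)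
    show "solves_bvp \<zeta> 1 bc_zero bc_right f (\<lambda>x. u x - single_layer ?\<sigma> \<zeta> x)"
      by (rule solves_bvp_diff_exp[OF u, where k = "u \<zeta> * exp \<zeta>" and e = "- 1"])
        (use \<zeta> in \<open>auto simp: single_layer_def G_def bc_right_def bc_zero_def simp flip: exp_add\<close>)
  qed
  show ?thesis
  proof (intro conjI allI impI)
    fix f u
    assume "solves_bvp 0 1 bc_left bc_right f u"
    from 4[OF this] obtain \<sigma> where \<sigma>:
      "solves_bvp 0 \<zeta> bc_left bc_zero f (\<lambda>x. u x - single_layer \<sigma> \<zeta> x)"
      "solves_bvp \<zeta> 1 bc_zero bc_right f (\<lambda>x. u x - single_layer \<sigma> \<zeta> x)"
      by blast
    show "\<exists>\<sigma>. solves_bvp 0 \<zeta> bc_left bc_zero f (\<lambda>x. u x - single_layer \<sigma> \<zeta> x) \<and>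
        solves_bvp \<zeta> 1 bc_zero bc_right f (\<lambda>x. u x - single_layer \<sigma> \<zeta> x) \<and>
        (\<forall>u\<^sub>1. solves_bvp 0 \<zeta> bc_left bc_zero f u\<^sub>1 \<longrightarrow>
          (\<forall>x\<in>{0..\<zeta>}. u\<^sub>1 x = u x - single_layer \<sigma> \<zeta> x)) \<and>
        (\<forall>u\<^sub>2. solves_bvp \<zeta> 1 bc_zero bc_right f u\<^sub>2 \<longrightarrow>
          (\<forall>x\<in>{\<zeta>..1}. u\<^sub>2 x = u x - single_layer \<sigma> \<zeta> x))"
      \<comment> \<open>The same \<sigma> serves both children; uniqueness identifies every child
        solution with the corrected parent solution.\<close>
      by (intro exI[of _ \<sigma>] conjI allI impI ballI \<sigma>;
          rule solves_bvp_unique, assumption, rule \<sigma>, simp, assumption)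
  next
    show "positive_definite_kernel 0 \<zeta> (G_l \<gamma>)"
      unfolding Gl by (rule positive_definite_left_kernel[OF \<zeta>(1)])
    show "positive_definite_kernel \<zeta> 1 (G_r \<gamma>)"
      unfolding Gr by (rule positive_definite_right_kernel[OF \<zeta>(2)])
    show "solves_bvp 0 1 bc_left bc_right f (kernel_op 0 1 G f)" if "continuous_on {0..1} f" for f
      using 3 that by (simp add: is_greens_function_def)
  qed (fact 1 2)+
qed

end
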